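(* Let $a,b\in\mathbb Z$ with $a>1$, $b>1$, such that $F(x)=x^4+ax^2+b$ is irreducible over $\mathbb Q$ and monogenic, and assume that for every prime $p$ we have $\nu_p(a)<2$ or $\nu_p(b)<4$. Let $\alpha$ be a root of $F(x)$ and $K=\mathbb Q(\alpha)$. Suppose there do not exist $u,v\in\mathbb Z$ with $v\ne 0$, $u\ne\pm1$ such that $a=\frac{u+1}{v}$ or $a=\frac{u-1}{v}$, and $b=\frac{u^2-1}{4v^2}$. Then, up to equivalence, $\alpha$ is the only generator of power integral bases of $K$; i.e. every $\gamma\in\mathbb Z_K$ with $\mathbb Z_K=\mathbb Z[\gamma]$ is equivalent to $\alpha$.
   Context: $\mathbb Z_K$ is the ring of integers of $K$ and $\nu_p$ the $p$-adic valuation. $F$ is monogenic means $\mathbb Z[\alpha]=\mathbb Z_K$ for a root $\alpha$ of $F$. An element $\gamma\in\mathbb Z_K$ generates a power integral basis if $(1,\gamma,\gamma^2,\gamma^3)$ is a $\mathbb Z$-basis of $\mathbb Z_K$. Two elements $\gamma,\beta\in\mathbb Z_K$ are equivalent if $\gamma+\beta\in\mathbb Z$ or $\gamma-\beta\in\mathbb Z$. *)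

theory Defs
  imports Complex_Main "HOL-Computational_Algebra.Computational_Algebra"
begin

text \<open>Number fields are taken inside the complex numbers.\<close>

definition rat_adjoin :: "complex \<Rightarrow> complex set" where
  "rat_adjoin \<alpha> =
     {poly (map_poly of_rat p) \<alpha> / poly (map_poly of_rat q) \<alpha> | (p :: rat poly) (q :: rat poly).
        poly (map_poly of_rat q) \<alpha> \<noteq> 0}"

definition int_adjoin :: "complex \<Rightarrow> complex set" where
  "int_adjoin \<gamma> = {poly (map_poly of_int p) \<gamma> | p :: int poly. True}"

definition ring_of_integers :: "complex set \<Rightarrow> complex set" where
  "ring_of_integers K = {x \<in> K. algebraic_int x}"

text \<open>For irreducible polynomials, the only case of interest, the choice of the root is irrelevant,
  since all roots are conjugate.\<close>

definition monogenic_poly :: "int poly \<Rightarrow> bool" where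
  "monogenic_poly F \<longleftrightarrow>
     (\<exists>\<alpha>::complex. poly (map_poly of_int F) \<alpha> = 0 \<and>
        int_adjoin \<alpha> = ring_of_integers (rat_adjoin \<alpha>))"

text \<open>For quartic fields: the family \<open>(1, \<gamma>, \<gamma>\<^sup>2, \<gamma>\<^sup>3)\<close> is a basis of the additive group of
  integers of \<open>K\<close>, that is, taking integer linear combinations of it is a bijection onto that
  group.\<close>

definition generates_power_integral_basis :: "complex set \<Rightarrow> complex \<Rightarrow> bool" where
  "generates_power_integral_basis K \<gamma> \<longleftrightarrow>
     \<gamma> \<in> ring_of_integers K \<and>
     bij_betw (\<lambda>(c0 :: int, c1 :: int, c2 :: int, c3 :: int).
         of_int c0 + of_int c1 * \<gamma> + of_int c2 * \<gamma> ^ 2 + of_int c3 * \<gamma> ^ 3)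
       UNIV (ring_of_integers K)"

definition pib_equivalent :: "complex \<Rightarrow> complex \<Rightarrow> bool" where
  "pib_equivalent \<gamma> \<beta> \<longleftrightarrow> \<gamma> + \<beta> \<in> \<int> \<or> \<gamma> - \<beta> \<in> \<int>"

end

theory Submission
  imports Defs "HOL-Computational_Algebra.Field_as_Ring"
begin

text \<open>
  Let \<open>\<gamma> = c + x \<alpha> + y \<alpha>\<^sup>2 + z \<alpha>\<^sup>3\<close> generate a power integral basis. The index form of
  \<open>\<int>[\<alpha>]\<close> splits as the product of \<open>A = x\<^sup>2 - a x z + b z\<^sup>2\<close> and \<open>(A + a q)\<^sup>2 - 4 b q\<^sup>2\<close>
  with \<open>q = y\<^sup>2 - x z + a z\<^sup>2\<close>, so both factors are units. The second one cannot be \<open>-1\<close>,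
  by reduction modulo 4. If \<open>q \<noteq> 0\<close>, then \<open>u = A + a q\<close> and \<open>v = q\<close> give the excluded
  representation of \<open>a\<close> and \<open>b\<close>. If \<open>q = 0\<close>, then \<open>A = (x - a z)\<^sup>2 + a y\<^sup>2 + b z\<^sup>2\<close>, and
  as \<open>a\<close> and \<open>b\<close> exceed 1 this forces \<open>y = z = 0\<close> and \<open>x = \<plusminus>1\<close>.
\<close>

subsection \<open>Evaluation of rational polynomials\<close>

text \<open>The evaluation rules are stated for an abstract map \<open>h\<close> so that the
  embeddings \<open>of_rat\<close> and \<open>of_int\<close> share one proof.\<close>

lemma poly_map_poly_add:
  assumes "h 0 = 0" and "\<And>u v. h (u + v) = h u + h v"
  shows "poly (map_poly h (p + q)) x = poly (map_poly h p) x + poly (map_poly h q) x"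
proof -
  have "map_poly h (p + q) = map_poly h p + map_poly h q"
    by (intro poly_eqI) (simp add: coeff_map_poly assms)
  then show ?thesis by simp
qed

lemma poly_map_poly_mult:
  fixes h :: "'a :: comm_ring_1 \<Rightarrow> 'b :: comm_ring_1"
  assumes "h 0 = 0" and "\<And>u v. h (u + v) = h u + h v" and "\<And>u v. h (u * v) = h u * h v"
  shows "poly (map_poly h (p * q)) x = poly (map_poly h p) x * poly (map_poly h q) x"
  by (induction p)
     (simp_all add: map_poly_pCons poly_map_poly_add map_poly_smult assms algebra_simps)

lemma poly_map_poly_pcompose:
  fixes h :: "'a :: comm_ring_1 \<Rightarrow> 'b :: comm_ring_1"
  assumes "h 0 = 0" and "\<And>u v. h (u + v) = h u + h v" and "\<And>u v. h (u * v) = h u * h v"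
  shows "poly (map_poly h (pcompose p q)) x = poly (map_poly h p) (poly (map_poly h q) x)"
  by (induction p)
     (simp_all add: pcompose_pCons map_poly_pCons poly_map_poly_add poly_map_poly_mult assms)

lemmas poly_of_rat_add =
    poly_map_poly_add[of "of_rat :: rat \<Rightarrow> complex", OF of_rat_0 of_rat_add]
  and poly_of_rat_mult =
    poly_map_poly_mult[of "of_rat :: rat \<Rightarrow> complex", OF of_rat_0 of_rat_add of_rat_mult]
  and poly_of_rat_pcompose =
    poly_map_poly_pcompose[of "of_rat :: rat \<Rightarrow> complex", OF of_rat_0 of_rat_add of_rat_mult]
  and poly_of_int_pcompose =
    poly_map_poly_pcompose[of "of_int :: int \<Rightarrow> complex", OF of_int_0 of_int_add of_int_mult]

lemma poly_of_int_eq_of_rat: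
  "poly (map_poly of_int p) (x :: complex) = poly (map_poly of_rat (map_poly of_int p)) x"
proof -
  have "map_poly of_rat (map_poly of_int p) = (map_poly of_int p :: complex poly)"
    by (intro poly_eqI) (simp add: coeff_map_poly)
  then show ?thesis by simp
qed

section \<open>Rational relations and conjugate roots\<close>

lemma bezout_irreducible:
  fixes f p :: "rat poly"
  assumes "irreducible f" and "\<not> f dvd p"
  obtains r s where "r * f + s * p = 1"
proof -
  have "coprime f p"
    using assms by (intro prime_elem_imp_coprime field_poly_irreducible_imp_prime)
  then have "fst (bezout_coefficients f p) * f + snd (bezout_coefficients f p) * p = 1"
    using bezout_coefficients_fst_snd[of f p] by simp
  then show ?thesis by (rule that)
qed

text \<open>Otherwise a Bezout identity evaluated at \<alpha> would read
  \<open>0 = 1\<close>.\<close>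

lemma irreducible_dvd_of_common_root:
  fixes f p :: "rat poly" and \<alpha> :: complex
  assumes "irreducible f" and "poly (map_poly of_rat f) \<alpha> = 0"
    and "poly (map_poly of_rat p) \<alpha> = 0"
  shows "f dvd p"
proof (rule ccontr)
  assume "\<not> f dvd p"
  then obtain r s where "r * f + s * p = 1"
    using bezout_irreducible[OF assms(1)] by blast
  then have "poly (map_poly of_rat (r * f + s * p)) \<alpha> = 1" by simp
  then show False
    using assms(2,3) by (simp add: poly_of_rat_add poly_of_rat_mult)
qed

lemma conjugate_root:
  fixes f p :: "rat poly" and \<alpha> \<beta> :: complex
  assumes "irreducible f" and "poly (map_poly of_rat f) \<alpha> = 0"
    and "poly (map_poly of_rat f) \<beta> = 0" and "poly (map_poly of_rat p) \<alpha> = 0"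
  shows "poly (map_poly of_rat p) \<beta> = 0"
proof -
  obtain k where "p = f * k"
    using irreducible_dvd_of_common_root[OF assms(1,2,4)] by (elim dvdE)
  then show ?thesis using assms(3) by (simp add: poly_of_rat_mult)
qed

text \<open>If a monic integer polynomial \<open>g\<close> kills the value of \<open>r\<close> at
  \<alpha>, then the rational polynomial \<open>pcompose g r\<close> vanishes at \<alpha>, hence at
  its conjugate \<beta>, so the same \<open>g\<close> kills the value of \<open>r\<close> at
  \<beta>.\<close>

lemma conjugate_algebraic_int:
  fixes f r :: "rat poly" and \<alpha> \<beta> :: complex
  assumes f: "irreducible f" "poly (map_poly of_rat f) \<alpha> = 0" "poly (map_poly of_rat f) \<beta> = 0"
    and "algebraic_int (poly (map_poly of_rat r) \<alpha>)"
  shows "algebraic_int (poly (map_poly of_rat r) \<beta>)"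
proof -
  obtain g where g: "poly (map_poly of_int g) (poly (map_poly of_rat r) \<alpha>) = 0" "lead_coeff g = 1"
    using assms(4) by (auto simp: algebraic_int_altdef_ipoly)
  have "poly (map_poly of_rat (pcompose (map_poly of_int g) r)) \<alpha> = 0"
    using g(1) by (simp add: poly_of_rat_pcompose poly_of_int_eq_of_rat)
  then have "poly (map_poly of_rat (pcompose (map_poly of_int g) r)) \<beta> = 0"
    by (rule conjugate_root[OF f])
  then show ?thesis
    using g(2) by (auto simp: poly_of_rat_pcompose poly_of_int_eq_of_rat algebraic_int_altdef_ipoly)
qed

text \<open>A denominator not vanishing at \<alpha> is coprime to \<open>f\<close>, and its Bezout
  cofactor evaluates to its inverse. Polynomial expressions, unlike quotients, pass directly to a
  conjugate root.\<close>

lemma rat_adjoin_eq_range: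
  fixes f :: "rat poly" and \<alpha> :: complex
  assumes f: "irreducible f" "poly (map_poly of_rat f) \<alpha> = 0"
  shows "rat_adjoin \<alpha> = range (\<lambda>r :: rat poly. poly (map_poly of_rat r) \<alpha>)"
proof (intro equalityI subsetI)
  fix x assume "x \<in> rat_adjoin \<alpha>"
  then obtain p q where x: "x = poly (map_poly of_rat p) \<alpha> / poly (map_poly of_rat q) \<alpha>"
    and q: "poly (map_poly of_rat q) \<alpha> \<noteq> 0"
    by (auto simp: rat_adjoin_def)
  have "\<not> f dvd q"
    using q f(2) by (auto simp: poly_of_rat_mult elim!: dvdE)
  then obtain r s where "r * f + s * q = 1"
    using bezout_irreducible[OF f(1)] by blast
  then have "poly (map_poly of_rat (r * f + s * q)) \<alpha> = 1" by simp
  then have "poly (map_poly of_rat s) \<alpha> * poly (map_poly of_rat q) \<alpha> = 1"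
    using f(2) by (simp add: poly_of_rat_add poly_of_rat_mult)
  then have "x = poly (map_poly of_rat (p * s)) \<alpha>"
    using q unfolding x poly_of_rat_mult by (simp add: divide_simps)
  then show "x \<in> range (\<lambda>r :: rat poly. poly (map_poly of_rat r) \<alpha>)" by blast
next
  fix x assume "x \<in> range (\<lambda>r :: rat poly. poly (map_poly of_rat r) \<alpha>)"
  then obtain r :: "rat poly" where "x = poly (map_poly of_rat r) \<alpha>" by blast
  then have "x = poly (map_poly of_rat r) \<alpha> / poly (map_poly of_rat 1) \<alpha>"
    and "poly (map_poly of_rat 1) \<alpha> \<noteq> 0"
    by simp_all
  then show "x \<in> rat_adjoin \<alpha>"
    unfolding rat_adjoin_def by blast
qed

text \<open>\<open>monogenic_poly\<close> speaks of some root only; this carries the property over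
  to any other one. Integrality and the existence of an integer representation both transfer along
  conjugation.\<close>

lemma int_adjoin_eq_ring_of_integers_conjugate:
  fixes f :: "rat poly" and \<alpha> \<beta> :: complex
  assumes f: "irreducible f" "poly (map_poly of_rat f) \<alpha> = 0" "poly (map_poly of_rat f) \<beta> = 0"
    and mono: "int_adjoin \<alpha> = ring_of_integers (rat_adjoin \<alpha>)"
  shows "int_adjoin \<beta> = ring_of_integers (rat_adjoin \<beta>)"
proof (intro equalityI subsetI)
  fix x assume "x \<in> int_adjoin \<beta>"
  then obtain h where x: "x = poly (map_poly of_rat (map_poly of_int h)) \<beta>"
    by (auto simp: int_adjoin_def poly_of_int_eq_of_rat)
  have "poly (map_poly of_rat (map_poly of_int h)) \<alpha> \<in> int_adjoin \<alpha>"
    by (auto simp: int_adjoin_def poly_of_int_eq_of_rat)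
  then have "algebraic_int (poly (map_poly of_rat (map_poly of_int h)) \<alpha>)"
    unfolding mono ring_of_integers_def by simp
  then have "algebraic_int x"
    unfolding x by (rule conjugate_algebraic_int[OF f])
  then show "x \<in> ring_of_integers (rat_adjoin \<beta>)"
    unfolding ring_of_integers_def rat_adjoin_eq_range[OF f(1,3)] using x by blast
next
  fix x assume "x \<in> ring_of_integers (rat_adjoin \<beta>)"
  then obtain r where x: "x = poly (map_poly of_rat r) \<beta>" and "algebraic_int x"
    unfolding ring_of_integers_def rat_adjoin_eq_range[OF f(1,3)] by blast
  then have "algebraic_int (poly (map_poly of_rat r) \<alpha>)"
    using conjugate_algebraic_int[OF f(1,3,2)] by simp
  then have "poly (map_poly of_rat r) \<alpha> \<in> int_adjoin \<alpha>"
    unfolding mono ring_of_integers_def rat_adjoin_eq_range[OF f(1,2)] by blast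
  then obtain h where "poly (map_poly of_rat r) \<alpha> = poly (map_poly of_rat (map_poly of_int h)) \<alpha>"
    by (auto simp: int_adjoin_def poly_of_int_eq_of_rat)
  \<comment> \<open>The factor \<open>[:-1:]\<close> expresses subtraction, so that the rules for
    sums and products suffice.\<close>
  then have "poly (map_poly of_rat (r + [:-1:] * map_poly of_int h)) \<alpha> = 0"
    by (simp only: poly_of_rat_add poly_of_rat_mult) (simp add: map_poly_pCons)
  then have "poly (map_poly of_rat (r + [:-1:] * map_poly of_int h)) \<beta> = 0"
    by (rule conjugate_root[OF f])
  then have "x = poly (map_poly of_int h) \<beta>"
    unfolding x poly_of_int_eq_of_rat
    by (simp only: poly_of_rat_add poly_of_rat_mult) (simp add: map_poly_pCons)
  then show "x \<in> int_adjoin \<beta>"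
    by (auto simp: int_adjoin_def)
qed

text \<open>A nontrivial relation would be a nonzero polynomial of degree at most 3 divisible by
  \<open>f\<close>.\<close>

lemma quartic_independent:
  fixes f :: "rat poly" and \<alpha> :: complex and c0 c1 c2 c3 :: int
  assumes "irreducible f" and "poly (map_poly of_rat f) \<alpha> = 0" and "degree f = 4"
    and "of_int c0 + of_int c1 * \<alpha> + of_int c2 * \<alpha> ^ 2 + of_int c3 * \<alpha> ^ 3 = 0"
  shows "c0 = 0 \<and> c1 = 0 \<and> c2 = 0 \<and> c3 = 0"
proof -
  let ?p = "[:of_int c0, of_int c1, of_int c2, of_int c3:] :: rat poly"
  have "poly (map_poly of_rat ?p) \<alpha> = 0"
    using assms(4) by (simp add: map_poly_pCons algebra_simps power2_eq_square power3_eq_cube)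
  then have "f dvd ?p"
    by (rule irreducible_dvd_of_common_root[OF assms(1,2)])
  moreover have "degree ?p < 4" by (simp add: degree_pCons_eq_if)
  ultimately have "?p = 0"
    using assms(3) dvd_imp_degree_le[of f ?p] by fastforce
  then show ?thesis by simp
qed

subsection \<open>Cubic integer combinations\<close>

text \<open>This is the range of the coefficient map in
  \<open>generates_power_integral_basis\<close>. In general it is only an additive group, not a
  ring.\<close>

definition cubic_span :: "complex \<Rightarrow> complex set" where
  "cubic_span \<gamma> = {of_int c0 + of_int c1 * \<gamma> + of_int c2 * \<gamma> ^ 2 + of_int c3 * \<gamma> ^ 3
     | c0 c1 c2 c3 :: int. True}"

lemma cubic_span_subset_int_adjoin: "cubic_span \<gamma> \<subseteq> int_adjoin \<gamma>"
proof
  fix x assume "x \<in> cubic_span \<gamma>"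
  then obtain c0 c1 c2 c3 :: int
    where "x = of_int c0 + of_int c1 * \<gamma> + of_int c2 * \<gamma> ^ 2 + of_int c3 * \<gamma> ^ 3"
    unfolding cubic_span_def by blast
  then have "x = poly (map_poly of_int [:c0, c1, c2, c3:]) \<gamma>"
    by (simp add: map_poly_pCons algebra_simps power2_eq_square power3_eq_cube)
  then show "x \<in> int_adjoin \<gamma>" unfolding int_adjoin_def by blast
qed

text \<open>Multiplication by \<gamma> preserves the span, since the only new power
  \<open>\<gamma> ^ 4\<close> is rewritten with integer coefficients; Horner's scheme then reaches
  every integer polynomial.\<close>

lemma int_adjoin_eq_cubic_span:
  fixes \<gamma> :: complex and e0 e1 e2 e3 :: int
  assumes "\<gamma> ^ 4 = of_int e0 + of_int e1 * \<gamma> + of_int e2 * \<gamma> ^ 2 + of_int e3 * \<gamma> ^ 3"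
  shows "int_adjoin \<gamma> = cubic_span \<gamma>"
proof
  have "poly (map_poly of_int p) \<gamma> \<in> cubic_span \<gamma>" for p :: "int poly"
  proof (induction p)
    case 0
    have "(0 :: complex) =
        of_int 0 + of_int 0 * \<gamma> + of_int 0 * \<gamma> ^ 2 + of_int 0 * \<gamma> ^ 3"
      by simp
    then show ?case unfolding cubic_span_def map_poly_0 poly_0 by blast
  next
    case (pCons m p)
    then obtain c0 c1 c2 c3 :: int where
      "poly (map_poly of_int p) \<gamma> = of_int c0 + of_int c1 * \<gamma> + of_int c2 * \<gamma> ^ 2 + of_int c3 * \<gamma> ^ 3"
      unfolding cubic_span_def by blast
    then have "poly (map_poly of_int (pCons m p)) \<gamma> =
        of_int m + of_int c0 * \<gamma> + of_int c1 * \<gamma> ^ 2 + of_int c2 * \<gamma> ^ 3 + of_int c3 * \<gamma> ^ 4"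
      by (simp add: map_poly_pCons) (simp add: algebra_simps eval_nat_numeral)
    also have "\<dots> = of_int (m + c3 * e0) + of_int (c0 + c3 * e1) * \<gamma> +
        of_int (c1 + c3 * e2) * \<gamma> ^ 2 + of_int (c2 + c3 * e3) * \<gamma> ^ 3"
      unfolding assms by (simp add: algebra_simps)
    finally show ?case unfolding cubic_span_def by blast
  qed
  then show "int_adjoin \<gamma> \<subseteq> cubic_span \<gamma>" by (auto simp: int_adjoin_def)
qed (rule cubic_span_subset_int_adjoin)

text \<open>This allows the constant coordinate of a generator to be discarded.\<close>

lemma int_adjoin_diff_of_int:
  "int_adjoin (\<gamma> - of_int c) = int_adjoin \<gamma>"
proof -
  have sub: "int_adjoin (\<delta> - of_int d) \<subseteq> int_adjoin \<delta>" for \<delta> :: complex and d :: int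
  proof
    fix x assume "x \<in> int_adjoin (\<delta> - of_int d)"
    then obtain p where x: "x = poly (map_poly of_int p) (\<delta> - of_int d)"
      by (auto simp: int_adjoin_def)
    have "x = poly (map_poly of_int (pcompose p [:-d, 1:])) \<delta>"
      unfolding x poly_of_int_pcompose by (simp add: map_poly_pCons)
    then show "x \<in> int_adjoin \<delta>" unfolding int_adjoin_def by blast
  qed
  show ?thesis
    using sub[of \<gamma> c] sub[of "\<gamma> - of_int c" "-c"] by auto
qed

subsection \<open>The index form\<close>

text \<open>The nine equations say that the integer matrix \<open>m\<close> is a left inverse of
  \<open>n\<close>; determinants are multiplicative.\<close>

lemma det3_mult_eq_one:
  fixes m11 :: int
  assumes "m11 * n11 + m12 * n21 + m13 * n31 = 1" "m11 * n12 + m12 * n22 + m13 * n32 = 0"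
    "m11 * n13 + m12 * n23 + m13 * n33 = 0"
    "m21 * n11 + m22 * n21 + m23 * n31 = 0" "m21 * n12 + m22 * n22 + m23 * n32 = 1"
    "m21 * n13 + m22 * n23 + m23 * n33 = 0"
    "m31 * n11 + m32 * n21 + m33 * n31 = 0" "m31 * n12 + m32 * n22 + m33 * n32 = 0"
    "m31 * n13 + m32 * n23 + m33 * n33 = 1"
  shows "(n11 * (n22 * n33 - n23 * n32) - n12 * (n21 * n33 - n23 * n31)
     + n13 * (n21 * n32 - n22 * n31)) dvd 1"
proof -
  let ?M = "m11 * (m22 * m33 - m23 * m32) - m12 * (m21 * m33 - m23 * m31)
     + m13 * (m21 * m32 - m22 * m31)"
  let ?N = "n11 * (n22 * n33 - n23 * n32) - n12 * (n21 * n33 - n23 * n31)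
     + n13 * (n21 * n32 - n22 * n31)"
  let ?p = "\<lambda>x y z u v w. x * u + y * v + z * w"
  \<comment> \<open>The right-hand side is the determinant of the product matrix; each
    \<open>?p\<close> term is one of its entries, hence 0 or 1.\<close>
  have "?M * ?N =
     ?p m11 m12 m13 n11 n21 n31 * (?p m21 m22 m23 n12 n22 n32 * ?p m31 m32 m33 n13 n23 n33
       - ?p m21 m22 m23 n13 n23 n33 * ?p m31 m32 m33 n12 n22 n32)
   - ?p m11 m12 m13 n12 n22 n32 * (?p m21 m22 m23 n11 n21 n31 * ?p m31 m32 m33 n13 n23 n33
       - ?p m21 m22 m23 n13 n23 n33 * ?p m31 m32 m33 n11 n21 n31)
   + ?p m11 m12 m13 n13 n23 n33 * (?p m21 m22 m23 n11 n21 n31 * ?p m31 m32 m33 n12 n22 n32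
       - ?p m21 m22 m23 n12 n22 n32 * ?p m31 m32 m33 n11 n21 n31)"
    by algebra
  also have "\<dots> = 1" unfolding assms by simp
  finally show ?thesis by (metis dvd_triv_right)
qed

text \<open>The powers 4, 5 and 6 of \<alpha> are reduced by the quartic relation; for instance
  \<open>\<alpha> ^ 6 = (a ^ 2 - b) * \<alpha> ^ 2 + a * b\<close>.\<close>

lemma biquadratic_product:
  fixes \<alpha> a b :: complex
  assumes "\<alpha> ^ 4 = - a * \<alpha> ^ 2 - b"
  shows "(p0 + p1 * \<alpha> + p2 * \<alpha> ^ 2 + p3 * \<alpha> ^ 3) * (x * \<alpha> + y * \<alpha> ^ 2 + z * \<alpha> ^ 3) =
      (a * b * p3 * z - b * (p1 * z + p2 * y + p3 * x))
    + (p0 * x - b * (p2 * z + p3 * y)) * \<alpha>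
    + (p0 * y + p1 * x - a * (p1 * z + p2 * y + p3 * x) + (a ^ 2 - b) * p3 * z) * \<alpha> ^ 2
    + (p0 * z + p1 * y + p2 * x - a * (p2 * z + p3 * y)) * \<alpha> ^ 3"
  using assms by algebra

text \<open>Writing \<open>w = \<alpha>\<^sup>2\<close>, the element \<open>\<beta>\<close> satisfies \<open>(\<beta> - y w)\<^sup>2 = w (x + z w)\<^sup>2\<close>, which
  reduces to \<open>\<beta>\<^sup>2 + k + (l - 2 y \<beta>) w = 0\<close>; eliminating \<open>w\<close> gives the characteristic
  polynomial of \<open>\<beta>\<close>.\<close>

lemma biquadratic_charpoly:
  fixes \<alpha> a b x y z :: complex
  assumes \<alpha>: "\<alpha> ^ 4 = - a * \<alpha> ^ 2 - b" and \<beta>: "\<beta> = x * \<alpha> + y * \<alpha> ^ 2 + z * \<alpha> ^ 3"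
    and k: "k = 2 * b * x * z - b * y ^ 2 - a * b * z ^ 2"
    and l: "l = 2 * a * x * z - a * y ^ 2 - x ^ 2 - (a ^ 2 - b) * z ^ 2"
  shows "\<beta> ^ 4 = (a * k * l - k ^ 2 - b * l ^ 2) + (4 * b * y * l - 2 * a * y * k) * \<beta>
    + (a * l - 2 * k - 4 * b * y ^ 2) * \<beta> ^ 2 + (- 2 * a * y) * \<beta> ^ 3"
proof -
  define w where "w = \<alpha> ^ 2"
  have w: "w ^ 2 = - a * w - b"
    using \<alpha> by (simp add: w_def flip: power_mult)
  have "\<beta> - y * w = \<alpha> * (x + z * w)"
    by (simp add: \<beta> w_def algebra_simps eval_nat_numeral)
  then have "(\<beta> - y * w) ^ 2 = w * (x + z * w) ^ 2"
    by (simp add: w_def power_mult_distrib)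
  then have "\<beta> ^ 2 + k + (l - 2 * y * \<beta>) * w = 0"
    using w k l by algebra
  then have "(\<beta> ^ 2 + k) ^ 2 - a * (\<beta> ^ 2 + k) * (l - 2 * y * \<beta>) + b * (l - 2 * y * \<beta>) ^ 2 = 0"
    using w by algebra
  then show ?thesis by algebra
qed

text \<open>The characteristic polynomial of \<beta> is monic with integer coefficients, so the
  fourth power of \<beta> reduces.\<close>

lemma int_adjoin_biquadratic:
  fixes \<alpha> \<beta> :: complex and a b x y z :: int
  assumes "\<alpha> ^ 4 = - of_int a * \<alpha> ^ 2 - of_int b"
    and "\<beta> = of_int x * \<alpha> + of_int y * \<alpha> ^ 2 + of_int z * \<alpha> ^ 3"
  shows "int_adjoin \<beta> = cubic_span \<beta>"
proof -
  define k where "k = 2 * b * x * z - b * y ^ 2 - a * b * z ^ 2"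
  define l where "l = 2 * a * x * z - a * y ^ 2 - x ^ 2 - (a ^ 2 - b) * z ^ 2"
  have "\<beta> ^ 4 = of_int (a * k * l - k ^ 2 - b * l ^ 2) + of_int (4 * b * y * l - 2 * a * y * k) * \<beta>
    + of_int (a * l - 2 * k - 4 * b * y ^ 2) * \<beta> ^ 2 + of_int (- 2 * a * y) * \<beta> ^ 3"
    using biquadratic_charpoly[OF assms, of "of_int k" "of_int l"]
    by (simp add: k_def l_def)
  then show ?thesis by (rule int_adjoin_eq_cubic_span)
qed

text \<open>The coordinates of the first three powers of \<beta> with respect to those of \<alpha>,
  taken modulo constants, form an integer matrix. The span assumptions provide a left inverse, so
  its determinant, the index form, is a unit.\<close>

lemma index_form_unit:
  fixes \<alpha> \<beta> :: complex and a b x y z :: int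
  assumes \<alpha>: "\<alpha> ^ 4 = - of_int a * \<alpha> ^ 2 - of_int b"
    and indep: "\<And>c0 c1 c2 c3 :: int.
      of_int c0 + of_int c1 * \<alpha> + of_int c2 * \<alpha> ^ 2 + of_int c3 * \<alpha> ^ 3 = 0 \<Longrightarrow>
      c0 = 0 \<and> c1 = 0 \<and> c2 = 0 \<and> c3 = 0"
    and \<beta>: "\<beta> = of_int x * \<alpha> + of_int y * \<alpha> ^ 2 + of_int z * \<alpha> ^ 3"
    and span: "\<alpha> \<in> cubic_span \<beta>" "\<alpha> ^ 2 \<in> cubic_span \<beta>" "\<alpha> ^ 3 \<in> cubic_span \<beta>"
  defines "A \<equiv> x ^ 2 - a * x * z + b * z ^ 2" and "q \<equiv> y ^ 2 - x * z + a * z ^ 2"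
  shows "A * ((A + a * q) ^ 2 - 4 * b * q ^ 2) dvd 1"
proof -
  \<comment> \<open>The \<open>p\<close>'s and \<open>r\<close>'s are the coordinates of
    \<open>\<beta> ^ 2\<close> and \<open>\<beta> ^ 3\<close>, as computed by
    \<open>biquadratic_product\<close>.\<close>
  define p0 where "p0 = a * b * z ^ 2 - b * (y ^ 2 + 2 * x * z)"
  define p1 where "p1 = - 2 * b * y * z"
  define p2 where "p2 = x ^ 2 - a * (y ^ 2 + 2 * x * z) + (a ^ 2 - b) * z ^ 2"
  define p3 where "p3 = 2 * x * y - 2 * a * y * z"
  define r0 where "r0 = a * b * p3 * z - b * (p1 * z + p2 * y + p3 * x)"
  define r1 where "r1 = p0 * x - b * (p2 * z + p3 * y)"
  define r2 where
    "r2 = p0 * y + p1 * x - a * (p1 * z + p2 * y + p3 * x) + (a ^ 2 - b) * p3 * z"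
  define r3 where "r3 = p0 * z + p1 * y + p2 * x - a * (p2 * z + p3 * y)"
  have \<beta>2: "\<beta> ^ 2 = of_int p0 + of_int p1 * \<alpha> + of_int p2 * \<alpha> ^ 2 + of_int p3 * \<alpha> ^ 3"
  proof -
    have "\<beta> ^ 2 = (0 + of_int x * \<alpha> + of_int y * \<alpha> ^ 2 + of_int z * \<alpha> ^ 3) * 
        (of_int x * \<alpha> + of_int y * \<alpha> ^ 2 + of_int z * \<alpha> ^ 3)"
      by (simp add: \<beta> power2_eq_square)
    also note biquadratic_product[OF \<alpha>]
    finally show ?thesis
      by (simp add: p0_def p1_def p2_def p3_def power2_eq_square algebra_simps)
  qed
  have \<beta>3: "\<beta> ^ 3 = of_int r0 + of_int r1 * \<alpha> + of_int r2 * \<alpha> ^ 2 + of_int r3 * \<alpha> ^ 3"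
  proof -
    have "\<beta> ^ 3 = (of_int p0 + of_int p1 * \<alpha> + of_int p2 * \<alpha> ^ 2 + of_int p3 * \<alpha> ^ 3) * 
        (of_int x * \<alpha> + of_int y * \<alpha> ^ 2 + of_int z * \<alpha> ^ 3)"
      unfolding \<beta>2[symmetric] unfolding \<beta>[symmetric] by (simp add: eval_nat_numeral)
    also note biquadratic_product[OF \<alpha>]
    finally show ?thesis
      by (simp add: r0_def r1_def r2_def r3_def)
  qed
  \<comment> \<open>Each element of the span yields one row of the left inverse. The constant
    coordinate is dropped, which leaves a 3 by 3 system.\<close>
  have coords: "\<exists>m1 m2 m3. m1 * x + m2 * p1 + m3 * r1 = d1 \<and> m1 * y + m2 * p2 + m3 * r2 = d2
      \<and> m1 * z + m2 * p3 + m3 * r3 = d3"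
    if mem: "of_int d1 * \<alpha> + of_int d2 * \<alpha> ^ 2 + of_int d3 * \<alpha> ^ 3 \<in> cubic_span \<beta>" for d1 d2 d3 :: int
  proof -
    obtain m0 m1 m2 m3 :: int where
      "of_int d1 * \<alpha> + of_int d2 * \<alpha> ^ 2 + of_int d3 * \<alpha> ^ 3 =
        of_int m0 + of_int m1 * \<beta> + of_int m2 * \<beta> ^ 2 + of_int m3 * \<beta> ^ 3"
      using mem unfolding cubic_span_def by blast
    then have "of_int (m0 + m2 * p0 + m3 * r0) + of_int (m1 * x + m2 * p1 + m3 * r1 - d1) * \<alpha>
      + of_int (m1 * y + m2 * p2 + m3 * r2 - d2) * \<alpha> ^ 2
      + of_int (m1 * z + m2 * p3 + m3 * r3 - d3) * \<alpha> ^ 3 = 0"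
      unfolding \<beta>2 \<beta>3 unfolding \<beta> by (simp add: algebra_simps)
    from indep[OF this] show ?thesis by (intro exI[of _ m1] exI[of _ m2] exI[of _ m3]) simp
  qed
  obtain m11 m12 m13 where
    "m11 * x + m12 * p1 + m13 * r1 = 1" "m11 * y + m12 * p2 + m13 * r2 = 0"
    "m11 * z + m12 * p3 + m13 * r3 = 0"
    using coords[of 1 0 0] span(1) by auto
  moreover obtain m21 m22 m23 where
    "m21 * x + m22 * p1 + m23 * r1 = 0" "m21 * y + m22 * p2 + m23 * r2 = 1"
    "m21 * z + m22 * p3 + m23 * r3 = 0"
    using coords[of 0 1 0] span(2) by auto
  moreover obtain m31 m32 m33 where
    "m31 * x + m32 * p1 + m33 * r1 = 0" "m31 * y + m32 * p2 + m33 * r2 = 0"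
    "m31 * z + m32 * p3 + m33 * r3 = 1"
    using coords[of 0 0 1] span(3) by auto
  ultimately have "x * (p2 * r3 - p3 * r2) - y * (p1 * r3 - p3 * r1) + z * (p1 * r2 - p2 * r1) dvd 1"
    by (rule det3_mult_eq_one)
  \<comment> \<open>The determinant is the product, over pairs of conjugates, of differences of
    \<beta> divided by those of \<alpha>. The two pairs of opposite roots contribute
    \<open>x + z * w\<close> for the two values \<open>w\<close> of \<open>\<alpha> ^ 2\<close>,
    with product \<open>A\<close>; the other four pairs give the second factor.\<close>
  also have "x * (p2 * r3 - p3 * r2) - y * (p1 * r3 - p3 * r1) + z * (p1 * r2 - p2 * r1) =
      A * ((A + a * q) ^ 2 - 4 * b * q ^ 2)"
    unfolding r1_def r2_def r3_def p0_def p1_def p2_def p3_def A_def q_def by algebra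
  finally show ?thesis .
qed

section \<open>Solving the index form equation\<close>

lemma index_form_solutions:
  fixes a b x y z :: int
  defines "A \<equiv> x ^ 2 - a * x * z + b * z ^ 2" and "q \<equiv> y ^ 2 - x * z + a * z ^ 2"
  assumes ab: "a > 1" "b > 1"
    and unit: "A * ((A + a * q) ^ 2 - 4 * b * q ^ 2) dvd 1"
    and excl: "\<And>u v. v \<noteq> 0 \<Longrightarrow> u \<noteq> 1 \<Longrightarrow> u \<noteq> -1 \<Longrightarrow> a * v = u + 1 \<or> a * v = u - 1 \<Longrightarrow>
      4 * v ^ 2 * b \<noteq> u ^ 2 - 1"
  shows "y = 0 \<and> z = 0 \<and> (x = 1 \<or> x = -1)"
proof -
  have "A dvd 1" and "(A + a * q) ^ 2 - 4 * b * q ^ 2 dvd 1"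
    using unit dvd_mult_left dvd_mult_right by blast+
  then have A: "A = 1 \<or> A = -1"
    and "(A + a * q) ^ 2 - 4 * b * q ^ 2 = 1 \<or> (A + a * q) ^ 2 - 4 * b * q ^ 2 = -1"
    by (auto simp: zdvd1_eq)
  moreover have "(A + a * q) ^ 2 - 4 * b * q ^ 2 \<noteq> -1"
  proof
    assume *: "(A + a * q) ^ 2 - 4 * b * q ^ 2 = -1"
    have "(A + a * q) ^ 2 mod 4 = 0 \<or> (A + a * q) ^ 2 mod 4 = 1"
    proof (cases "even (A + a * q)")
      case True
      then obtain m where "A + a * q = 2 * m" by (elim evenE)
      then show ?thesis by (simp add: power_mult_distrib)
    next
      case False
      then obtain m where "A + a * q = 2 * m + 1" by (elim oddE)
      then have "(A + a * q) ^ 2 = 1 + 4 * (m ^ 2 + m)"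
        by (simp only:) (simp add: power2_eq_square algebra_simps)
      then show ?thesis by (simp only: mod_mult_self2) simp
    qed
    moreover have "(A + a * q) ^ 2 = 3 + 4 * (b * q ^ 2 - 1)" using * by simp
    then have "(A + a * q) ^ 2 mod 4 = 3" by (simp only: mod_mult_self2) simp
    ultimately show False by simp
  qed
  ultimately have B: "(A + a * q) ^ 2 - 4 * b * q ^ 2 = 1" by blast
  have "q = 0"
  proof (rule ccontr)
    assume q: "q \<noteq> 0"
    have "4 * b * q ^ 2 > 0" using q ab by simp
    \<comment> \<open>The candidate \<open>u = A + a * q\<close> has square
      \<open>1 + 4 * b * q ^ 2\<close>, which exceeds 1.\<close>
    then have "A + a * q \<noteq> 1" "A + a * q \<noteq> -1" using B by auto
    moreover have "a * q = (A + a * q) + 1 \<or> a * q = (A + a * q) - 1" using A by auto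
    ultimately have "4 * q ^ 2 * b \<noteq> (A + a * q) ^ 2 - 1" using q by (intro excl)
    then show False using B by (simp add: algebra_simps)
  qed
  \<comment> \<open>Completing the square shows that the right-hand side always equals
    \<open>A + a * q\<close>.\<close>
  then have *: "A = (x - a * z) ^ 2 + a * y ^ 2 + b * z ^ 2"
    unfolding A_def q_def by algebra
  have "(x - a * z) ^ 2 \<ge> 0" "a * y ^ 2 \<ge> 0" "b * z ^ 2 \<ge> 0" using ab by simp_all
  \<comment> \<open>A sum of nonnegative terms cannot be -1.\<close>
  with * A have sum1: "(x - a * z) ^ 2 + a * y ^ 2 + b * z ^ 2 = 1" by auto
  have "z = 0"
  proof (rule ccontr)
    assume "z \<noteq> 0"
    then have "z ^ 2 \<ge> 1" by (simp add: int_one_le_iff_zero_less)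
    then have "b * z ^ 2 \<ge> b * 1" using ab by (intro mult_left_mono) auto
    then show False
      using sum1 ab \<open>(x - a * z) ^ 2 \<ge> 0\<close> \<open>a * y ^ 2 \<ge> 0\<close> by linarith
  qed
  moreover have "y = 0"
  proof (rule ccontr)
    assume "y \<noteq> 0"
    then have "y ^ 2 \<ge> 1" by (simp add: int_one_le_iff_zero_less)
    then have "a * y ^ 2 \<ge> a * 1" using ab by (intro mult_left_mono) auto
    then show False
      using sum1 ab \<open>(x - a * z) ^ 2 \<ge> 0\<close> \<open>b * z ^ 2 \<ge> 0\<close> by linarith
  qed
  ultimately show ?thesis using sum1 by (simp add: power2_eq_1_iff)
qed

lemma int_adjoin_subset:
  assumes "\<gamma> \<in> int_adjoin \<alpha>"
  shows "int_adjoin \<gamma> \<subseteq> int_adjoin \<alpha>"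
proof
  fix x assume "x \<in> int_adjoin \<gamma>"
  then obtain p where "x = poly (map_poly of_int p) \<gamma>" by (auto simp: int_adjoin_def)
  moreover obtain h where "\<gamma> = poly (map_poly of_int h) \<alpha>"
    using assms by (auto simp: int_adjoin_def)
  ultimately have "x = poly (map_poly of_int (pcompose p h)) \<alpha>"
    by (simp add: poly_of_int_pcompose)
  then show "x \<in> int_adjoin \<alpha>" unfolding int_adjoin_def by blast
qed

section \<open>Generators of the ring of integers of \<open>K\<close>\<close>

theorem theorem2p4:
  fixes a b :: int and F :: "int poly" and \<alpha> :: complex and K :: "complex set"
  assumes "a > 1" and "b > 1"
    and "F = [:b, 0, a, 0, 1:]"
    and "irreducible (map_poly rat_of_int F)"
    and "monogenic_poly F"
    and "\<And>p :: int. prime p \<Longrightarrow> multiplicity p a < 2 \<or> multiplicity p b < 4"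
    and "poly (map_poly of_int F) \<alpha> = 0"
    and "K = rat_adjoin \<alpha>"
    and "\<not> (\<exists>u v :: int. v \<noteq> 0 \<and> u \<noteq> 1 \<and> u \<noteq> - 1 \<and>
           (rat_of_int a = (of_int u + 1) / of_int v \<or> rat_of_int a = (of_int u - 1) / of_int v) \<and>
           rat_of_int b = ((of_int u)\<^sup>2 - 1) / (4 * (of_int v)\<^sup>2))"
  shows "generates_power_integral_basis K \<alpha> \<and>
    (\<forall>\<gamma>. generates_power_integral_basis K \<gamma> \<longrightarrow> pib_equivalent \<gamma> \<alpha>) \<and>
    (\<forall>\<gamma> \<in> ring_of_integers K. ring_of_integers K = int_adjoin \<gamma> \<longrightarrow> pib_equivalent \<gamma> \<alpha>)"
proof -
  define f :: "rat poly" where "f = [:of_int b, 0, of_int a, 0, 1:]"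
  have fF: "f = map_poly rat_of_int F"
    by (simp add: f_def assms(3) map_poly_pCons)
  have irr: "irreducible f" using assms(4) fF by simp
  have f\<alpha>: "poly (map_poly of_rat f) \<alpha> = 0"
    using assms(7) unfolding fF poly_of_int_eq_of_rat .
  \<comment> \<open>Monogenicity may be witnessed by a root other than \<alpha>, hence the passage
    to a conjugate.\<close>
  obtain \<alpha>' where "poly (map_poly of_rat f) \<alpha>' = 0"
    and "int_adjoin \<alpha>' = ring_of_integers (rat_adjoin \<alpha>')"
    using assms(5) unfolding monogenic_poly_def fF poly_of_int_eq_of_rat by blast
  then have "int_adjoin \<alpha> = ring_of_integers (rat_adjoin \<alpha>)"
    using int_adjoin_eq_ring_of_integers_conjugate irr f\<alpha> by blast
  then have OK: "ring_of_integers K = int_adjoin \<alpha>" using assms(8) by simp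
  have "\<alpha> ^ 4 + of_int a * \<alpha> ^ 2 + of_int b = 0"
    using assms(7) unfolding assms(3)
    by (simp add: map_poly_pCons algebra_simps eval_nat_numeral)
  then have \<alpha>4: "\<alpha> ^ 4 = - of_int a * \<alpha> ^ 2 - of_int b" by algebra
  \<comment> \<open>This is the case \<open>x = 1\<close>, \<open>y = z = 0\<close>, in which
    \<beta> is \<alpha> itself.\<close>
  have "int_adjoin \<alpha> = cubic_span \<alpha>"
    using int_adjoin_biquadratic[OF \<alpha>4, of \<alpha> 1 0 0] by simp
  then have span: "ring_of_integers K = cubic_span \<alpha>" using OK by simp
  have "degree f = 4" by (simp add: f_def)
  note indep = quartic_independent[OF irr f\<alpha> this]
  let ?comb = "\<lambda>\<gamma> (c0 :: int, c1 :: int, c2 :: int, c3 :: int).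
    of_int c0 + of_int c1 * \<gamma> + of_int c2 * \<gamma> ^ 2 + of_int c3 * \<gamma> ^ 3 :: complex"
  have range_comb: "range (?comb \<gamma>) = cubic_span \<gamma>" for \<gamma>
    unfolding cubic_span_def image_def by (rule Collect_cong) (simp add: split_paired_Ex)
  have "inj (?comb \<alpha>)"
  proof (rule injI)
    fix u v assume eq: "?comb \<alpha> u = ?comb \<alpha> v"
    obtain c0 c1 c2 c3 d0 d1 d2 d3 where uv: "u = (c0, c1, c2, c3)" "v = (d0, d1, d2, d3)"
      by (metis prod_cases4)
    from eq have "of_int (c0 - d0) + of_int (c1 - d1) * \<alpha> + of_int (c2 - d2) * \<alpha> ^ 2
        + of_int (c3 - d3) * \<alpha> ^ 3 = 0"
      by (simp add: uv) (simp add: algebra_simps)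
    from indep[OF this] show "u = v" by (simp add: uv)
  qed
  moreover have "\<alpha> \<in> ring_of_integers K"
    unfolding span cubic_span_def
    by (rule CollectI, rule exI[of _ 0], rule exI[of _ 1], rule exI[of _ 0], rule exI[of _ 0]) simp
  ultimately have gen: "generates_power_integral_basis K \<alpha>"
    unfolding generates_power_integral_basis_def bij_betw_def range_comb span by simp
  have int_gen: "pib_equivalent \<gamma> \<alpha>"
    if \<gamma>: "\<gamma> \<in> ring_of_integers K" and "ring_of_integers K = int_adjoin \<gamma>" for \<gamma>
  proof -
    obtain c x y z :: int where
      xyz: "\<gamma> = of_int c + of_int x * \<alpha> + of_int y * \<alpha> ^ 2 + of_int z * \<alpha> ^ 3"
      using \<gamma> unfolding span cubic_span_def by blast
    define \<beta> where "\<beta> = \<gamma> - of_int c"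
    have \<beta>: "\<beta> = of_int x * \<alpha> + of_int y * \<alpha> ^ 2 + of_int z * \<alpha> ^ 3"
      by (simp add: \<beta>_def xyz)
    have "cubic_span \<beta> = int_adjoin \<alpha>"
      using int_adjoin_biquadratic[OF \<alpha>4 \<beta>] int_adjoin_diff_of_int[of \<gamma> c] that(2) OK
      by (simp add: \<beta>_def)
    moreover have "\<alpha> ^ n \<in> int_adjoin \<alpha>" for n
      unfolding int_adjoin_def
      by (rule CollectI, rule exI[of _ "monom 1 n"]) (simp add: map_poly_monom poly_monom)
    ultimately have "\<alpha> ^ n \<in> cubic_span \<beta>" for n by simp
    from this[of 1] this[of 2] this[of 3]
    have unit: "(x\<^sup>2 - a * x * z + b * z\<^sup>2) * ((x\<^sup>2 - a * x * z + b * z\<^sup>2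
        + a * (y\<^sup>2 - x * z + a * z\<^sup>2))\<^sup>2 - 4 * b * (y\<^sup>2 - x * z + a * z\<^sup>2)\<^sup>2) dvd 1"
      by (intro index_form_unit[OF \<alpha>4 indep \<beta>]) simp_all
    \<comment> \<open>The excluded representation is turned into its integer form by clearing
      denominators, which is legitimate as \<open>v \<noteq> 0\<close>.\<close>
    have "4 * v ^ 2 * b \<noteq> u ^ 2 - 1"
      if "v \<noteq> 0" "u \<noteq> 1" "u \<noteq> -1" "a * v = u + 1 \<or> a * v = u - 1" for u v
    proof
      assume "4 * v ^ 2 * b = u ^ 2 - 1"
      then have "rat_of_int (4 * v ^ 2 * b) = rat_of_int (u ^ 2 - 1)" by (simp only:)
      then have "rat_of_int b = ((of_int u)\<^sup>2 - 1) / (4 * (of_int v)\<^sup>2)"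
        using that(1) by (simp add: field_simps)
      moreover have "rat_of_int (a * v) = rat_of_int (u + 1) \<or> rat_of_int (a * v) = rat_of_int (u - 1)"
        using that(4) by metis
      then have "rat_of_int a = (of_int u + 1) / of_int v \<or> rat_of_int a = (of_int u - 1) / of_int v"
        using that(1) by (simp add: field_simps)
      ultimately show False using assms(9) that(1-3) by blast
    qed
    with index_form_solutions[OF assms(1,2) unit]
    have "y = 0 \<and> z = 0 \<and> (x = 1 \<or> x = -1)" by blast
    \<comment> \<open>The signs \<open>x = 1\<close> and \<open>x = -1\<close> correspond to the two
      alternatives of \<open>pib_equivalent\<close>.\<close>
    then have "\<gamma> - \<alpha> = of_int c \<or> \<gamma> + \<alpha> = of_int c" by (auto simp: xyz)
    then show ?thesis unfolding pib_equivalent_def by (metis Ints_of_int)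
  qed
  have "pib_equivalent \<gamma> \<alpha>" if "generates_power_integral_basis K \<gamma>" for \<gamma>
  proof (rule int_gen)
    show \<gamma>: "\<gamma> \<in> ring_of_integers K"
      using that by (simp add: generates_power_integral_basis_def)
    \<comment> \<open>Surjectivity of the coefficient map gives this equality. The ring generated by
      \<gamma> is then squeezed between \<open>cubic_span \<gamma>\<close> and
      \<open>int_adjoin \<alpha>\<close>, both equal to the ring of integers.\<close>
    have "ring_of_integers K = cubic_span \<gamma>"
      using that unfolding generates_power_integral_basis_def bij_betw_def range_comb by simp
    then show "ring_of_integers K = int_adjoin \<gamma>"
      using cubic_span_subset_int_adjoin[of \<gamma>] int_adjoin_subset[of \<gamma> \<alpha>] \<gamma> OK by auto
  qed
  with gen int_gen show ?thesis by blast
qed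

end
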